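(* For $n\ge 1$ let $p_n$ be the number of distinct words of length $n$ that occur in sequences belonging to the countable-substitution subshift $\Sigma\subset\{a,b\}^{\mathbb Z}$. Then $$\lim_{n\to\infty}\frac{p_n}{n^3}=\frac16 .$$
   Context: For $i\ge 1$ define words $\zeta_i(j)$, $0\le j\le i$, over $\{a,b\}$ by $\zeta_i(i)=b$ and $\zeta_i(0)=a$ for all $i\ge 1$, and $\zeta_i(j)=\zeta_{i-1}(j)\zeta_{i-1}(j-1)$ (concatenation) for $i\ge 2$, $0<j<i$. Let $\mathcal L(\zeta)$ be the set of all subwords (contiguous factors) of all words $\zeta_i(j)$, $i\ge 1$, $0\le j\le i$. $\Sigma$ is the set of all sequences in $\{a,b\}^{\mathbb Z}$ all of whose finite subwords belong to $\mathcal L(\zeta)$. *)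

theory Defs
  imports Complex_Main "HOL-Library.Sublist"
begin

datatype letter = La | Lb

text \<open>
  The words \<open>\<zeta>\<^sub>i(j)\<close> are only meaningful for \<open>i \<ge> 1\<close> and \<open>0 \<le> j \<le> i\<close>; outside this range
  the function returns the empty word as a dummy value. In the branch with the concatenation,
  \<open>0 < j < Suc i\<close> holds, so the row index \<open>Suc i\<close> is at least 2 there.
\<close>

fun zeta :: "nat \<Rightarrow> nat \<Rightarrow> letter list" where
  "zeta 0 j = []"
| "zeta (Suc i) j =
     (if j = Suc i then [Lb]
      else if j = 0 then [La]
      else if j < Suc i then zeta i j @ zeta i (j - 1)
      else [])"

definition zeta_language :: "letter list set" where
  "zeta_language = {w. \<exists>i j. 1 \<le> i \<and> j \<le> i \<and> sublist w (zeta i j)}"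

definition subword_at :: "(int \<Rightarrow> letter) \<Rightarrow> int \<Rightarrow> nat \<Rightarrow> letter list" where
  "subword_at x k n = map (\<lambda>t. x (k + int t)) [0..<n]"

definition Sigma_shift :: "(int \<Rightarrow> letter) set" where
  "Sigma_shift = {x. \<forall>k n. subword_at x k n \<in> zeta_language}"

definition complexity :: "nat \<Rightarrow> nat" where
  "complexity n = card {w. \<exists>x\<in>Sigma_shift. \<exists>k. w = subword_at x k n}"

end

theory Submission
  imports Defs "HOL-Real_Asymp.Real_Asymp"
begin

text \<open>
  Every word of length at least 2 in the language straddles the cut of some
  \<open>\<zeta>\<^sub>i(k) \<zeta>\<^sub>i(k - 1)\<close>. A suffix of \<open>\<zeta>\<^sub>i(k)\<close> of length \<open>p\<close> depends only on \<open>l = i - k\<close>, and only on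
  \<open>min l p\<close> because \<open>\<zeta>\<^sub>i(k)\<close> ends in \<open>b a\<^sup>l\<close>; dually, prefixes of length \<open>n - p\<close> depend only on
  the second index \<open>j\<close>, since \<open>\<zeta>\<^sub>i(j)\<close> starts with \<open>b\<^sup>j a\<close>. So a word of length \<open>n\<close> is given by a
  triple \<open>(p, l, j)\<close> with \<open>l \<le> p\<close> and \<open>j \<le> n - p\<close>, of which there are about \<open>n\<^sup>3 / 6\<close>. Conversely, if
  \<open>l < p\<close>, \<open>j < n - p\<close> and \<open>l + j\<close> is at least of order \<open>\<surd>n\<close>, then the window is contained in
  \<open>\<zeta>\<^sub>i(j + 1)\<close> for \<open>i = l + j + 2\<close>, where a block \<open>b a\<^sup>l b\<^sup>j a\<close> of maximal length occurs only at
  the cut; hence the triple can be read off the word. The excluded triples number \<open>O(n\<^sup>2)\<close>.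
\<close>

section \<open>The words \<open>\<zeta>\<^sub>i(j)\<close>\<close>

declare zeta.simps(2) [simp del]

lemma zeta_diag: "1 \<le> i \<Longrightarrow> zeta i i = [Lb]"
  by (cases i) (simp_all add: zeta.simps(2))

lemma zeta_0_right: "1 \<le> i \<Longrightarrow> zeta i 0 = [La]"
  by (cases i) (simp_all add: zeta.simps(2))

lemma zeta_Suc: "0 < k \<Longrightarrow> k \<le> i \<Longrightarrow> zeta (Suc i) k = zeta i k @ zeta i (k - 1)"
  by (simp add: zeta.simps(2))

text \<open>The concatenation rule turns into Pascal's rule for the lengths.\<close>

lemma length_zeta: "1 \<le> i \<Longrightarrow> k \<le> i \<Longrightarrow> length (zeta i k) = i choose k"
proof (induction i arbitrary: k rule: dec_induct)
  case base
  then show ?case by (cases "k = 0") (auto simp: zeta.simps(2) le_Suc_eq)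
next
  case (step i)
  show ?case
  proof (cases "k = 0 \<or> k = Suc i")
    case True
    then show ?thesis by (auto simp: zeta.simps(2))
  next
    case False
    then obtain m where "k = Suc m" "m < i" using step.prems by (cases k) auto
    then show ?thesis using step.IH by (simp add: zeta_Suc)
  qed
qed

text \<open>For \<open>0 < k\<close> the word \<open>zeta m k\<close> is the left factor of
  \<open>zeta (Suc m) k\<close>, so the words with second index \<open>k\<close> form a chain of
  prefixes.\<close>

lemma prefix_zeta_mono:
  assumes "1 \<le> i" "k \<le> i" "i \<le> i'"
  shows "prefix (zeta i k) (zeta i' k)"
  using assms(3)
proof (induction i' rule: dec_induct)
  case (step m)
  have "prefix (zeta m k) (zeta (Suc m) k)"
    using step.hyps assms by (cases "k = 0") (auto simp: zeta_Suc zeta_0_right)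
  then show ?case using step.IH prefix_order.trans by blast
qed simp

text \<open>The dual chain: for \<open>0 < l\<close> the word \<open>zeta m (m - l)\<close> is the
  right factor of \<open>zeta (Suc m) (Suc m - l)\<close>.\<close>

lemma suffix_zeta_mono:
  assumes "1 \<le> i" "l \<le> i" "i \<le> i'"
  shows "suffix (zeta i (i - l)) (zeta i' (i' - l))"
  using assms(3)
proof (induction i' rule: dec_induct)
  case (step m)
  have "suffix (zeta m (m - l)) (zeta (Suc m) (Suc m - l))"
    using step.hyps assms by (cases "l = 0") (auto simp: zeta_Suc zeta_diag Suc_diff_le suffix_def)
  then show ?case using step.IH suffix_order.trans by blast
qed simp

section \<open>Leading and trailing runs\<close>

lemma prefix_zeta_run:
  assumes "k < i"
  shows "prefix (replicate k Lb @ [La]) (zeta i k)"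
proof (cases "k = 0")
  case True
  then show ?thesis using assms by (simp add: zeta_0_right)
next
  case False
  \<comment> \<open>The first word off the diagonal is exactly the claimed prefix; the prefix chain
    carries it to all later rows.\<close>
  have "zeta (Suc k) k = replicate k Lb @ [La]" if "1 \<le> k" for k
    using that
  proof (induction k rule: dec_induct)
    case base
    show ?case by (simp add: zeta.simps(2))
  next
    case (step k)
    have "zeta (Suc (Suc k)) (Suc k) = zeta (Suc k) (Suc k) @ zeta (Suc k) k"
      by (simp add: zeta_Suc)
    then show ?case using step.IH by (simp add: zeta_diag)
  qed
  with False have "zeta (Suc k) k = replicate k Lb @ [La]" by simp
  then show ?thesis using prefix_zeta_mono[of "Suc k" k i] assms by simp
qed

lemma suffix_zeta_run:
  assumes "0 < k" "k \<le> i"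
  shows "suffix (Lb # replicate (i - k) La) (zeta i k)"
proof -
  define l where "l = i - k"
  \<comment> \<open>This is the first word with positive second index in the suffix chain for
    \<open>l\<close>.\<close>
  have "zeta (Suc l) 1 = Lb # replicate l La"
  proof (induction l)
    case 0
    show ?case by (simp add: zeta.simps(2))
  next
    case (Suc l)
    then show ?case
      by (simp add: zeta_Suc zeta_0_right replicate_append_same)
  qed
  then show ?thesis
    using suffix_zeta_mono[of "Suc l" l i] assms by (simp add: l_def)
qed

lemma leading_run_unique:
  assumes "replicate j Lb @ La # y = replicate j' Lb @ La # y'"
  shows "j = j'"
proof -
  have "takeWhile (\<lambda>c. c = Lb) (replicate j Lb @ La # y) = replicate j Lb" for j y
    by (simp add: takeWhile_append)
  then show ?thesis using assms by (metis length_replicate)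
qed

lemma trailing_run_unique:
  assumes "x @ Lb # replicate l La = x' @ Lb # replicate l' La"
  shows "l = l'"
proof -
  have "takeWhile (\<lambda>c. c = La) (rev (x @ Lb # replicate l La)) = replicate l La" for l x
    by (simp add: takeWhile_append)
  then show ?thesis using assms by (metis length_replicate)
qed

text \<open>Recovers the second index from the first \<open>a\<close>. On the diagonal the word is
  \<open>[Lb]\<close> and contains no \<open>a\<close>.\<close>

lemma zeta_leading_run:
  assumes "1 \<le> i" "k \<le> i" "zeta i k = replicate j Lb @ La # y"
  shows "j = k"
proof (cases "k = i")
  case True
  then show ?thesis using assms by (cases j) (simp_all add: zeta_diag)
next
  case False
  then obtain z where "zeta i k = replicate k Lb @ La # z"
    using assms prefix_zeta_run[of k i] by (auto simp: prefix_def)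
  then show ?thesis using assms leading_run_unique by metis
qed

lemma zeta_trailing_run:
  assumes "1 \<le> i" "k \<le> i" "zeta i k = x @ Lb # replicate l La"
  shows "l = i - k"
proof (cases "k = 0")
  case True
  then show ?thesis using assms by (cases x) (simp_all add: zeta_0_right)
next
  case False
  then obtain z where "zeta i k = z @ Lb # replicate (i - k) La"
    using assms suffix_zeta_run[of k i] by (auto simp: suffix_def)
  then show ?thesis using assms trailing_run_unique by metis
qed

section \<open>Every word of the language occurs in the subshift\<close>

lemma zeta_language_sublist: "w \<in> zeta_language \<Longrightarrow> sublist v w \<Longrightarrow> v \<in> zeta_language"
  unfolding zeta_language_def using sublist_order.order.trans by blast

text \<open>\<open>zeta i j\<close> occurs in \<open>zeta (i + 2) (j + 1)\<close> with nonempty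
  words on both sides, so each of its factors can be extended both ways.\<close>

lemma zeta_language_extend:
  assumes "w \<in> zeta_language"
  shows "\<exists>c d. c # w @ [d] \<in> zeta_language"
proof -
  obtain i j where ij: "1 \<le> i" "j \<le> i" "sublist w (zeta i j)"
    using assms by (auto simp: zeta_language_def)
  then obtain u v where w: "zeta i j = u @ w @ v" by (auto simp: sublist_def)
  have "\<exists>p q. p \<noteq> [] \<and> q \<noteq> [] \<and> zeta (Suc (Suc i)) (Suc j) = p @ zeta i j @ q"
  proof -
    have ne: "zeta m k \<noteq> []" if "1 \<le> m" "k \<le> m" for m k
      using length_zeta[OF that] that by (auto simp flip: length_greater_0_conv)
    consider "j = i" | "j < i" using ij by linarith
    then show ?thesis
    proof cases
      case 1
      then have "zeta (Suc (Suc i)) (Suc j) = [Lb] @ zeta i j @ zeta i (i - 1)"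
        using ij by (simp add: zeta_Suc zeta_diag)
      then show ?thesis using ne[of i "i - 1"] ij
        by (intro exI[of _ "[Lb]"] exI[of _ "zeta i (i - 1)"]) simp
    next
      case 2
      then have "zeta (Suc (Suc i)) (Suc j) = zeta i (Suc j) @ zeta i j @ zeta (Suc i) j"
        using ij by (simp add: zeta_Suc)
      then show ?thesis using ne[of i "Suc j"] ne[of "Suc i" j] ij 2
        by (intro exI[of _ "zeta i (Suc j)"] exI[of _ "zeta (Suc i) j"]) simp
    qed
  qed
  then obtain p q where "p \<noteq> []" "q \<noteq> []" "zeta (Suc (Suc i)) (Suc j) = (p @ u) @ w @ (v @ q)"
    using w by auto
  moreover obtain p' c where "p @ u = p' @ [c]" using \<open>p \<noteq> []\<close>
    by (metis Nil_is_append_conv rev_exhaust)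
  moreover obtain d q' where "v @ q = d # q'" using \<open>q \<noteq> []\<close>
    by (metis Nil_is_append_conv neq_Nil_conv)
  ultimately have "zeta (Suc (Suc i)) (Suc j) = p' @ (c # w @ [d]) @ q'" by simp
  then have "sublist (c # w @ [d]) (zeta (Suc (Suc i)) (Suc j))" by (metis sublist_def)
  then show ?thesis unfolding zeta_language_def using ij
    by (intro exI[of _ c] exI[of _ d] CollectI exI[of _ "Suc (Suc i)"] exI[of _ "Suc j"]) auto
qed

text \<open>Iterating the two-sided extension gives nested words \<open>W k\<close>, with
  \<open>W k\<close> on the positions from \<open>-k\<close> to \<open>length w + k - 1\<close>;
  their union is the sequence \<open>x\<close>.\<close>

lemma zeta_language_occurs:
  assumes "w \<in> zeta_language"
  shows "\<exists>x\<in>Sigma_shift. w = subword_at x 0 (length w)"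
proof -
  obtain f where f: "\<And>w. w \<in> zeta_language \<Longrightarrow>
      f w \<in> zeta_language \<and> (\<exists>c d. f w = c # w @ [d])"
  proof -
    have "\<forall>w. \<exists>v. w \<in> zeta_language \<longrightarrow> v \<in> zeta_language \<and> (\<exists>c d. v = c # w @ [d])"
      using zeta_language_extend by blast
    from choice[OF this] show ?thesis using that by blast
  qed
  define W where "W k = (f ^^ k) w" for k
  have W_lang: "W k \<in> zeta_language" for k
    by (induction k) (auto simp: W_def assms f)
  have W_Suc: "\<exists>c d. W (Suc k) = c # W k @ [d]" for k
    using f[OF W_lang[of k]] by (simp add: W_def)
  have len: "length (W k) = length w + 2 * k" for k
  proof (induction k)
    case (Suc k)
    then show ?case using W_Suc[of k] by auto
  qed (simp add: W_def)
  have shift: "W (k + m) ! (t + m) = W k ! t" if "t < length w + 2 * k" for k m t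
  proof (induction m)
    case (Suc m)
    then show ?case using W_Suc[of "k + m"] len[of "k + m"] that by (auto simp: nth_append)
  qed simp
  \<comment> \<open>Stage \<open>\<bar>t\<bar> + 1\<close> covers position \<open>t\<close> even if
    \<open>w\<close> is empty.\<close>
  define x where "x t = W (nat \<bar>t\<bar> + 1) ! nat (t + int (nat \<bar>t\<bar> + 1))" for t
  have align: "W k ! nat (t + int k) = W m ! nat (t + int m)"
    if "- int k \<le> t" "t < int (length w) + int k" "k \<le> m" for t k m
  proof -
    have e: "nat (t + int k) + (m - k) = nat (t + int m)" "k + (m - k) = m"
      using that by auto
    have "nat (t + int k) < length w + 2 * k" using that by linarith
    from shift[OF this, of "m - k"] show ?thesis unfolding e by simp
  qed
  have x_eq: "x t = W k ! nat (t + int k)"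
    if "- int k \<le> t" "t < int (length w) + int k" for t k
  proof -
    \<comment> \<open>Two stages agree because both are compared with a common later one.\<close>
    define m where "m = max k (nat \<bar>t\<bar> + 1)"
    have "x t = W m ! nat (t + int m)"
      unfolding x_def by (rule align) (auto simp: m_def)
    also have "\<dots> = W k ! nat (t + int k)"
      using that by (intro align[symmetric]) (auto simp: m_def)
    finally show ?thesis .
  qed
  have "subword_at x k n \<in> zeta_language" for k n
  proof -
    define K where "K = nat \<bar>k\<bar> + n + 1"
    have K: "nat (k + int K) + n \<le> length (W K)" by (auto simp: len K_def)
    have "subword_at x k n = take n (drop (nat (k + int K)) (W K))"
    proof (rule nth_equalityI)
      show "length (subword_at x k n) = length (take n (drop (nat (k + int K)) (W K)))"
        using K by (simp add: subword_at_def)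
      fix t assume "t < length (subword_at x k n)"
      then have t: "t < n" by (simp add: subword_at_def)
      then have "x (k + int t) = W K ! nat (k + int t + int K)"
        by (intro x_eq) (auto simp: K_def)
      moreover have "nat (k + int t + int K) = nat (k + int K) + t" by (auto simp: K_def)
      ultimately show "subword_at x k n ! t = take n (drop (nat (k + int K)) (W K)) ! t"
        using t K by (simp add: subword_at_def)
    qed
    moreover have "sublist (take n (drop m (W K))) (W K)" for m
      by (meson sublist_drop sublist_take sublist_order.order.trans)
    ultimately show ?thesis using W_lang zeta_language_sublist by metis
  qed
  then have "x \<in> Sigma_shift" by (simp add: Sigma_shift_def)
  moreover have "w = subword_at x 0 (length w)"
  proof (rule nth_equalityI)
    fix t assume "t < length w"
    then show "w ! t = subword_at x 0 (length w) ! t"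
      using x_eq[of 0 "int t"] by (simp add: subword_at_def W_def)
  qed (simp add: subword_at_def)
  ultimately show ?thesis by blast
qed

text \<open>From here on only finite words have to be counted.\<close>

lemma complexity_eq_card_language:
  "complexity n = card {w \<in> zeta_language. length w = n}"
proof -
  have "{w. \<exists>x\<in>Sigma_shift. \<exists>k. w = subword_at x k n} = {w \<in> zeta_language. length w = n}"
  proof (intro equalityI subsetI)
    fix w assume "w \<in> {w \<in> zeta_language. length w = n}"
    then show "w \<in> {w. \<exists>x\<in>Sigma_shift. \<exists>k. w = subword_at x k n}"
      using zeta_language_occurs by blast
  qed (auto simp: Sigma_shift_def subword_at_def)
  then show ?thesis by (simp add: complexity_def)
qed

section \<open>The upper bound\<close>

definition zeta_suffixes :: "nat \<Rightarrow> letter list set" where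
  "zeta_suffixes p = {s. length s = p \<and> (\<exists>i k. 1 \<le> i \<and> k \<le> i \<and> suffix s (zeta i k))}"

definition zeta_prefixes :: "nat \<Rightarrow> letter list set" where
  "zeta_prefixes q = {s. length s = q \<and> (\<exists>i k. 1 \<le> i \<and> k \<le> i \<and> prefix s (zeta i k))}"

text \<open>Counting scheme for both bounds below: one exceptional word, and at most one word for
  each parameter \<open>l < p\<close>.\<close>

lemma card_insert_subsingletons:
  assumes "A \<subseteq> insert a (\<Union>l<p. B l)" "\<And>l x y. x \<in> B l \<Longrightarrow> y \<in> B l \<Longrightarrow> x = y"
  shows "finite A" "card A \<le> Suc p"
proof -
  have B: "finite (B l)" "card (B l) \<le> 1" for l
  proof -
    have "B l = {} \<or> (\<exists>x. B l = {x})" using assms(2) by blast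
    then show "finite (B l)" "card (B l) \<le> 1" by auto
  qed
  have fin: "finite (insert a (\<Union>l<p. B l))" using B by auto
  show "finite A" using assms(1) fin by (rule finite_subset)
  have "card A \<le> card (insert a (\<Union>l<p. B l))" using fin assms(1) by (rule card_mono)
  also have "\<dots> \<le> Suc (card (\<Union>l<p. B l))" by (rule card_insert_le_m1) auto
  also have "card (\<Union>l<p. B l) \<le> (\<Sum>l<p. card (B l))" by (rule card_UN_le) simp
  also have "(\<Sum>l<p. card (B l)) \<le> (\<Sum>l<p. 1)" using B by (intro sum_mono) auto
  finally show "card A \<le> Suc p" by simp
qed

text \<open>The suffix chain leaves at most one word for each \<open>l = i - k < p\<close>. If
  \<open>l \<ge> p\<close>, the trailing run swallows the whole suffix.\<close>

lemma zeta_suffixes_bound: "finite (zeta_suffixes p)" "card (zeta_suffixes p) \<le> Suc p"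
proof -
  let ?B = "\<lambda>l. {s. length s = p \<and> (\<exists>i. 1 \<le> i \<and> l \<le> i \<and> suffix s (zeta i (i - l)))}"
  have uniq: "s = t" if "s \<in> ?B l" "t \<in> ?B l" for l s t
  proof -
    from that obtain i i' where *: "1 \<le> i" "l \<le> i" "suffix s (zeta i (i - l))"
      "1 \<le> i'" "l \<le> i'" "suffix t (zeta i' (i' - l))" "length s = length t"
      by auto
    \<comment> \<open>Both suffixes are moved to a common row, where equal length forces
      equality.\<close>
    let ?m = "max i i'"
    have "suffix s (zeta ?m (?m - l))" "suffix t (zeta ?m (?m - l))"
      using * suffix_zeta_mono[of i l ?m] suffix_zeta_mono[of i' l ?m] suffix_order.trans
      by (meson max.cobounded1 max.cobounded2)+
    with *(7) show "s = t" by (auto simp: suffix_def)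
  qed
  have sub: "zeta_suffixes p \<subseteq> insert (replicate p La) (\<Union>l<p. ?B l)"
  proof
    fix s assume "s \<in> zeta_suffixes p"
    then obtain i k where s: "length s = p" "1 \<le> i" "k \<le> i" "suffix s (zeta i k)"
      by (auto simp: zeta_suffixes_def)
    show "s \<in> insert (replicate p La) (\<Union>l<p. ?B l)"
    proof (cases "i - k < p")
      case True
      have "i - (i - k) = k" using s by simp
      then have "s \<in> ?B (i - k)" using s by (auto intro!: exI[of _ i])
      with True show ?thesis by blast
    next
      case False
      have "set s \<subseteq> {La}"
      proof (cases "k = 0")
        case True
        then show ?thesis using s set_mono_suffix[OF s(4)] by (simp add: zeta_0_right)
      next
        case k: False
        then have "suffix (Lb # replicate (i - k) La) (zeta i k)"
          using s suffix_zeta_run by simp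
        then have "suffix (replicate (i - k) La) (zeta i k)" by (rule suffix_ConsD)
        then have "suffix s (replicate (i - k) La)"
          using suffix_length_suffix[OF s(4)] s(1) False by simp
        then show ?thesis using set_mono_suffix by fastforce
      qed
      then have "s = replicate p La" using s(1) by (intro replicate_eqI) auto
      then show ?thesis by blast
    qed
  qed
  show "finite (zeta_suffixes p)"
    by (rule card_insert_subsingletons(1)[OF sub], rule uniq)
  show "card (zeta_suffixes p) \<le> Suc p"
    by (rule card_insert_subsingletons(2)[OF sub], rule uniq)
qed


text \<open>Dual argument, with the second index \<open>k\<close> as the parameter and the prefix
  chain in place of the suffix chain.\<close>

lemma zeta_prefixes_bound: "finite (zeta_prefixes q)" "card (zeta_prefixes q) \<le> Suc q"
proof -
  let ?B = "\<lambda>k. {s. length s = q \<and> (\<exists>i. 1 \<le> i \<and> k \<le> i \<and> prefix s (zeta i k))}"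
  have uniq: "s = t" if "s \<in> ?B k" "t \<in> ?B k" for k s t
  proof -
    from that obtain i i' where *: "1 \<le> i" "k \<le> i" "prefix s (zeta i k)"
      "1 \<le> i'" "k \<le> i'" "prefix t (zeta i' k)" "length s = length t"
      by auto
    let ?m = "max i i'"
    have "prefix s (zeta ?m k)" "prefix t (zeta ?m k)"
      using * prefix_zeta_mono[of i k ?m] prefix_zeta_mono[of i' k ?m] prefix_order.trans
      by (meson max.cobounded1 max.cobounded2)+
    with *(7) show "s = t" by (auto simp: prefix_def)
  qed
  have sub: "zeta_prefixes q \<subseteq> insert (replicate q Lb) (\<Union>k<q. ?B k)"
  proof
    fix s assume "s \<in> zeta_prefixes q"
    then obtain i k where s: "length s = q" "1 \<le> i" "k \<le> i" "prefix s (zeta i k)"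
      by (auto simp: zeta_prefixes_def)
    show "s \<in> insert (replicate q Lb) (\<Union>k<q. ?B k)"
    proof (cases "k < q")
      case True
      have "s \<in> ?B k" using s by auto
      with True show ?thesis by blast
    next
      case False
      have "set s \<subseteq> {Lb}"
      proof (cases "k = i")
        case True
        then show ?thesis using s set_mono_prefix[OF s(4)] by (simp add: zeta_diag)
      next
        case k: False
        then have "prefix (replicate k Lb) (zeta i k)"
          using s prefix_zeta_run[of k i] append_prefixD by fastforce
        then have "prefix s (replicate k Lb)"
          using prefix_length_prefix[OF s(4)] s(1) False by simp
        then show ?thesis using set_mono_prefix by fastforce
      qed
      then have "s = replicate q Lb" using s(1) by (intro replicate_eqI) auto
      then show ?thesis by blast
    qed
  qed
  show "finite (zeta_prefixes q)"
    by (rule card_insert_subsingletons(1)[OF sub], rule uniq)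
  show "card (zeta_prefixes q) \<le> Suc q"
    by (rule card_insert_subsingletons(2)[OF sub], rule uniq)
qed

text \<open>In the smallest word \<open>\<zeta>\<^sub>i(j)\<close> containing \<open>w\<close>, the word \<open>w\<close> must straddle the cut of the
  defining concatenation.\<close>

lemma zeta_language_split:
  assumes "w \<in> zeta_language" "2 \<le> length w"
  shows "\<exists>u v. w = u @ v \<and> u \<noteq> [] \<and> v \<noteq> [] \<and>
    u \<in> zeta_suffixes (length u) \<and> v \<in> zeta_prefixes (length v)"
proof -
  obtain i j where "j \<le> i" "sublist w (zeta i j)"
    using assms by (auto simp: zeta_language_def)
  then show ?thesis
  proof (induction i arbitrary: j)
    case 0
    then show ?case using assms(2) by auto
  next
    case (Suc i)
    show ?case
    proof (cases "j = 0 \<or> j = Suc i")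
      case True
      then have "length (zeta (Suc i) j) = 1" by (auto simp: length_zeta)
      then show ?thesis using sublist_length_le[OF Suc.prems(2)] assms(2) by simp
    next
      case False
      then have j: "0 < j" "j \<le> i" using Suc.prems by auto
      then have "sublist w (zeta i j @ zeta i (j - 1))" using Suc.prems by (simp add: zeta_Suc)
      \<comment> \<open>If one part of a straddling decomposition is empty, \<open>w\<close> lies in
        a single factor, which is one of the first two cases.\<close>
      then consider "sublist w (zeta i j)" | "sublist w (zeta i (j - 1))"
        | u v where "w = u @ v" "u \<noteq> []" "v \<noteq> []"
            "suffix u (zeta i j)" "prefix v (zeta i (j - 1))"
        unfolding sublist_append
        by (metis append.left_neutral append.right_neutral prefix_imp_sublist suffix_imp_sublist)
      then show ?thesis
      proof cases
        case 1
        then show ?thesis using Suc.IH j by blast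
      next
        case 2
        then show ?thesis using Suc.IH[of "j - 1"] j by simp
      next
        case (3 u v)
        have i: "1 \<le> i" "j - 1 \<le> i" using j by auto
        have "u \<in> zeta_suffixes (length u)"
          unfolding zeta_suffixes_def using 3(4) i(1) j(2) by blast
        moreover have "v \<in> zeta_prefixes (length v)"
          unfolding zeta_prefixes_def using 3(5) i by blast
        ultimately show ?thesis using 3 by blast
      qed
    qed
  qed
qed

text \<open>Sum over the length \<open>p\<close> of the part left of the cut; the two parts are
  chosen independently.\<close>

lemma complexity_le:
  assumes "2 \<le> n"
  shows "complexity n \<le> (\<Sum>p<n. Suc p * Suc (n - p))"
proof -
  let ?C = "\<lambda>p. (\<lambda>(u, v). u @ v) ` (zeta_suffixes p \<times> zeta_prefixes (n - p))"
  have "{w \<in> zeta_language. length w = n} \<subseteq> (\<Union>p<n. ?C p)"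
  proof
    fix w assume "w \<in> {w \<in> zeta_language. length w = n}"
    then have w: "w \<in> zeta_language" "length w = n" by auto
    then obtain u v where uv: "w = u @ v" "v \<noteq> []"
      "u \<in> zeta_suffixes (length u)" "v \<in> zeta_prefixes (length v)"
      using zeta_language_split assms by blast
    then have "length u < n" "length v = n - length u" using w by auto
    then have "w \<in> ?C (length u)" using uv by auto
    with \<open>length u < n\<close> show "w \<in> (\<Union>p<n. ?C p)" by blast
  qed
  moreover have "finite (\<Union>p<n. ?C p)"
    by (intro finite_UN_I finite_imageI finite_cartesian_product zeta_suffixes_bound(1)
        zeta_prefixes_bound(1) finite_lessThan)
  ultimately have "complexity n \<le> card (\<Union>p<n. ?C p)"
    unfolding complexity_eq_card_language by (intro card_mono)
  also have "\<dots> \<le> (\<Sum>p<n. card (?C p))" by (rule card_UN_le) simp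
  also have "\<dots> \<le> (\<Sum>p<n. Suc p * Suc (n - p))"
  proof (rule sum_mono)
    fix p
    have "card (?C p) \<le> card (zeta_suffixes p \<times> zeta_prefixes (n - p))"
      by (intro card_image_le finite_cartesian_product zeta_suffixes_bound(1) zeta_prefixes_bound(1))
    also have "\<dots> \<le> Suc p * Suc (n - p)"
      unfolding card_cartesian_product
      by (intro mult_le_mono zeta_suffixes_bound zeta_prefixes_bound)
    finally show "card (?C p) \<le> Suc p * Suc (n - p)" .
  qed
  finally show ?thesis .
qed

section \<open>The lower bound\<close>

text \<open>A block \<open>b a\<^sup>l b\<^sup>j a\<close> in \<open>\<zeta>\<^sub>i(k)\<close> of the largest possible length is located at the cut of
  the defining concatenation, so it occurs only once.\<close>

lemma zeta_block:
  assumes "1 \<le> i" "k \<le> i" "1 \<le> l" "1 \<le> j"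
    and "zeta i k = x @ Lb # replicate l La @ replicate j Lb @ La # y"
  shows "l + j + 2 \<le> i \<and> (l + j + 2 = i \<longrightarrow> length x + 1 + l = length (zeta (i - 1) k))"
  using assms(1,2,5)
proof (induction i arbitrary: k x y rule: dec_induct)
  case base
  then have "k = 0 \<or> k = 1" by auto
  then have "length (zeta 1 k) = 1" by (auto simp: length_zeta)
  then show ?case using base by simp
next
  case (step i)
  let ?w = "x @ Lb # replicate l La @ replicate j Lb @ La # y"
  show ?case
  proof (cases "k = 0 \<or> k = Suc i")
    case True
    then have "length (zeta (Suc i) k) = 1" by (auto simp: length_zeta)
    then show ?thesis using step.prems by simp
  next
    case False
    then have k: "0 < k" "k \<le> i" using step.prems by auto
    define U V where UV: "U = zeta i k" "V = zeta i (k - 1)"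
    define c where "c = length U"
    have "U @ V = ?w" using step.prems k by (simp add: zeta_Suc UV)
    then have U: "U = take c ?w" and V: "V = drop c ?w"
      by (metis append_eq_conv_conj c_def)+
    \<comment> \<open>Position of the cut: after the block, before it, before some \<open>a\<close>
      of the \<open>a\<close>-run, between the two runs, or after some \<open>b\<close> of the
      \<open>b\<close>-run.\<close>
    consider "length x + l + j + 2 \<le> c" | "c \<le> length x" | "length x < c" "c \<le> length x + l"
      | "c = length x + l + 1" | "length x + l + 1 < c" "c < length x + l + j + 2"
      by linarith
    then show ?thesis
    proof cases
      case 1
      \<comment> \<open>A block inside one factor satisfies \<open>l + j + 2 \<le> i\<close> by
        induction, so the equality for row \<open>Suc i\<close> cannot hold.\<close>
      define d where "d = c - (length x + l + j + 2)"
      have "zeta i k = x @ Lb # replicate l La @ replicate j Lb @ La # take d y"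
      proof -
        have "c = length (x @ Lb # replicate l La @ replicate j Lb @ [La]) + d"
          using 1 by (simp add: d_def)
        moreover have "?w = (x @ Lb # replicate l La @ replicate j Lb @ [La]) @ y" by simp
        ultimately have "take c ?w = (x @ Lb # replicate l La @ replicate j Lb @ [La]) @ take d y"
          by (metis append_take_drop_id append_eq_conv_conj take_add drop_append diff_self_eq_0 drop_all order_refl append_Nil drop0)
        then show ?thesis using U UV by simp
      qed
      then show ?thesis using step.IH k by fastforce
    next
      case 2
      then have "zeta i (k - 1) = drop c x @ Lb # replicate l La @ replicate j Lb @ La # y"
        using V UV by simp
      then show ?thesis using step.IH[of "k - 1"] k by fastforce
    next
      case 3
      \<comment> \<open>The right factor begins with \<open>a\<close>, hence is the single letter
        \<open>[La]\<close>, but it still has to hold the rest of the block.\<close>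
      have len: "3 \<le> length V" using 3 assms by (simp add: V)
      obtain m where m: "c = Suc (length x + m)" "m < l"
        using 3 by (metis Suc_le_eq less_iff_Suc_add add_Suc_right nat_add_left_cancel_le)
      then obtain r where r: "l - m = Suc r" by (metis Suc_diff_Suc)
      then have "zeta i (k - 1) = replicate 0 Lb @ La # (replicate r La @ replicate j Lb @ La # y)"
        using m V UV by simp
      then have "k - 1 = 0" using zeta_leading_run[of i "k - 1" 0] step.hyps k by simp
      then have "length V = 1" using UV step.hyps by (simp add: zeta_0_right)
      with len show ?thesis by simp
    next
      case 4
      \<comment> \<open>The runs on either side of the cut give \<open>l = i - k\<close> and
        \<open>j = k - 1\<close>, so \<open>l + j + 2 = Suc i\<close>.\<close>
      then have "zeta i k = x @ Lb # replicate l La" using U UV by simp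
      then have l: "l = i - k" using zeta_trailing_run step.hyps k by blast
      have "zeta i (k - 1) = replicate j Lb @ La # y" using 4 V UV by simp
      then have "j = k - 1" using zeta_leading_run[of i "k - 1"] step.hyps k by simp
      then show ?thesis using l k 4 by (simp add: c_def UV)
    next
      case 5
      \<comment> \<open>The left factor ends in \<open>b\<close> and so is \<open>[Lb]\<close>, too
        short for the \<open>b a\<close> that starts the block.\<close>
      define m where "m = c - (length x + l + 2)"
      have m: "c = Suc (Suc (length x + l + m))" "m < j" using 5 by (auto simp: m_def)
      have "zeta i k = (x @ Lb # replicate l La @ replicate m Lb) @ Lb # replicate 0 La"
        using U UV m by (simp add: min_def replicate_append_same)
      then have "i - k = 0" using zeta_trailing_run[of i k _ 0] step.hyps k by metis
      then have "c = 1" using k step.hyps by (simp add: c_def UV length_zeta)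
      with 5 show ?thesis by simp
    qed
  qed
qed

section \<open>Windows around the cut\<close>

text \<open>The factor of length \<open>n\<close> around the cut of \<open>\<zeta>\<^sub>i(j + 1)\<close>, \<open>i = l + j + 2\<close>, with \<open>p\<close> letters
  to the left of the cut; it is shorter than \<open>n\<close> if \<open>\<zeta>\<^sub>i(j + 1)\<close> does not extend far enough.\<close>

definition window :: "nat \<Rightarrow> nat \<Rightarrow> nat \<Rightarrow> nat \<Rightarrow> letter list" where
  "window n p l j =
     drop (length (zeta (l + j + 1) (j + 1)) - p) (zeta (l + j + 1) (j + 1)) @
     take (n - p) (zeta (l + j + 1) j)"

text \<open>The last condition makes \<open>\<zeta>\<^sub>i(j + 1)\<close> extend far enough, as its two halves have length at least
  \<open>l + j + 1\<close> choose 2.\<close>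

definition good_triples :: "nat \<Rightarrow> (nat \<times> nat \<times> nat) set" where
  "good_triples n = {(p, l, j). 2 \<le> l \<and> l < p \<and> 2 \<le> j \<and> p + j < n \<and> 2 * n \<le> (l + j)\<^sup>2}"

lemma le_binomial: "0 < k \<Longrightarrow> k < m \<Longrightarrow> m \<le> m choose k"
proof (induction m arbitrary: k)
  case (Suc m)
  obtain k' where k: "k = Suc k'" using Suc.prems by (cases k) auto
  show ?case
  proof (cases "k' = 0 \<or> k = m")
    case True
    then show ?thesis using k Suc.prems by auto
  next
    case False
    then show ?thesis using Suc.IH[of k] Suc.IH[of k'] k Suc.prems by simp
  qed
qed simp

text \<open>Pascal's rule splits the entry into one that is at least \<open>m choose 2\<close> by
  induction and one that is at least \<open>m\<close>; these add up to
  \<open>Suc m choose 2\<close>. The end case \<open>k + 2 = Suc m\<close> is symmetry.\<close>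

lemma choose_two_le_binomial: "2 \<le> k \<Longrightarrow> k + 2 \<le> m \<Longrightarrow> m choose 2 \<le> m choose k"
proof (induction m arbitrary: k)
  case (Suc m)
  obtain k' where k: "k = Suc k'" using Suc.prems by (cases k) auto
  consider "k = 2" | "k + 2 = Suc m" | "2 < k" "k + 2 \<le> m" using Suc.prems by linarith
  then show ?case
  proof cases
    case 2
    have "Suc m choose k = Suc m choose (Suc m - k)"
      using 2 by (intro binomial_symmetric) simp
    also have "Suc m - k = 2" using 2 by simp
    finally have e: "Suc m choose k = Suc m choose 2" .
    show ?thesis by (simp only: e order.refl)
  next
    case 3
    then have "m choose 2 \<le> m choose k" "m \<le> m choose k'"
      using Suc.IH[of k] le_binomial[of k' m] k by auto
    moreover have "Suc m choose 2 = m + (m choose 2)"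
      by (simp add: numeral_2_eq_2)
    ultimately show ?thesis using k by simp
  qed simp
qed simp

lemma good_triples_length:
  assumes "(p, l, j) \<in> good_triples n"
  shows "p \<le> length (zeta (l + j + 1) (j + 1))" "n - p \<le> length (zeta (l + j + 1) j)"
proof -
  have *: "2 \<le> l" "l < p" "2 \<le> j" "p + j < n" "2 * n \<le> (l + j)\<^sup>2"
    using assms by (auto simp: good_triples_def)
  have "2 * n \<le> (l + j + 1) * (l + j)" using *(5) by (simp add: power2_eq_square)
  then have "n \<le> (l + j + 1) choose 2" by (simp add: choose_two)
  \<comment> \<open>Here \<open>2 \<le> l\<close> and \<open>2 \<le> j\<close> keep both lower
    indices at distance at least 2 from the ends of the row.\<close>
  moreover have "(l + j + 1) choose 2 \<le> (l + j + 1) choose (j + 1)"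
    "(l + j + 1) choose 2 \<le> (l + j + 1) choose j"
    using * by (auto intro!: choose_two_le_binomial simp del: binomial_Suc_Suc)
  ultimately show "p \<le> length (zeta (l + j + 1) (j + 1))" "n - p \<le> length (zeta (l + j + 1) j)"
    using * by (auto simp: length_zeta simp del: binomial_Suc_Suc)
qed

text \<open>Collects the two views of a window: its visible block, whose \<open>a\<close>-run ends
  at position \<open>p\<close>, and its place in a word whose cut is at that same position.\<close>

lemma window_cases:
  assumes "(p, l, j) \<in> good_triples n"
  obtains x y x' y' where
    "window n p l j = x @ Lb # replicate l La @ replicate j Lb @ La # y"
    "length x + 1 + l = p" "length (window n p l j) = n"
    "zeta (l + j + 2) (j + 1) = x' @ window n p l j @ y'"
    "length x' + p = length (zeta (l + j + 1) (j + 1))"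
proof -
  have *: "2 \<le> l" "l < p" "2 \<le> j" "p + j < n"
    using assms by (auto simp: good_triples_def)
  define U V where UV: "U = zeta (l + j + 1) (j + 1)" "V = zeta (l + j + 1) j"
  define u v where uv: "u = drop (length U - p) U" "v = take (n - p) V"
  note len = good_triples_length[OF assms, folded UV]
  have lu: "length u = p" "length v = n - p" using len by (simp_all add: uv)
  have "suffix (Lb # replicate l La) U"
    using suffix_zeta_run[of "j + 1" "l + j + 1"] by (simp add: UV)
  then have "suffix (Lb # replicate l La) u"
    by (rule suffix_length_suffix) (use lu * in \<open>simp_all add: uv suffix_drop\<close>)
  then obtain x where x: "u = x @ Lb # replicate l La" by (auto simp: suffix_def)
  have "prefix (replicate j Lb @ [La]) V"
    using prefix_zeta_run[of j "l + j + 1"] by (simp add: UV)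
  then have "prefix (replicate j Lb @ [La]) v"
    by (rule prefix_length_prefix) (use lu * in \<open>simp_all add: uv take_is_prefix\<close>)
  then obtain y where y: "v = replicate j Lb @ La # y" by (auto simp: prefix_def)
  have w: "window n p l j = u @ v" by (simp add: window_def UV uv)
  show thesis
  proof (rule that)
    show "window n p l j = x @ Lb # replicate l La @ replicate j Lb @ La # y"
      by (simp add: w x y)
    show "length x + 1 + l = p" using arg_cong[OF x, of length] lu by simp
    show "length (window n p l j) = n" using lu * unfolding w by simp
    have "zeta (l + j + 2) (j + 1) = U @ V" using zeta_Suc[of "j + 1" "l + j + 1"] * by (simp add: UV)
    also have "\<dots> = take (length U - p) U @ window n p l j @ drop (n - p) V"
      unfolding w uv by (metis append.assoc append_take_drop_id)
    finally show "zeta (l + j + 2) (j + 1) = take (length U - p) U @ window n p l j @ drop (n - p) V" .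
    show "length (take (length U - p) U) + p = length (zeta (l + j + 1) (j + 1))"
      unfolding UV[symmetric] using len by simp
  qed
qed

lemma window_in_language:
  assumes "(p, l, j) \<in> good_triples n"
  shows "window n p l j \<in> {w \<in> zeta_language. length w = n}"
proof -
  from assms obtain x' y' where "length (window n p l j) = n"
    "zeta (l + j + 2) (j + 1) = x' @ window n p l j @ y'"
    by (rule window_cases)
  then have "sublist (window n p l j) (zeta (l + j + 2) (j + 1))" by (metis sublist_appendI)
  moreover have "1 \<le> l + j + 2" "j + 1 \<le> l + j + 2" by simp_all
  ultimately have "window n p l j \<in> zeta_language" unfolding zeta_language_def by blast
  then show ?thesis using \<open>length (window n p l j) = n\<close> by simp
qed

text \<open>The block of the first window also occurs in the word around the second.
  \<open>zeta_block\<close> bounds its length there and, for equal sums, puts it at the cut.\<close>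

lemma window_eq_le:
  assumes "(p, l, j) \<in> good_triples n" "(p', l', j') \<in> good_triples n"
    and eq: "window n p l j = window n p' l' j'"
  shows "l + j \<le> l' + j'" "l + j = l' + j' \<Longrightarrow> p = p'"
proof -
  have "1 \<le> l" "1 \<le> j" using assms(1) by (auto simp: good_triples_def)
  from assms(1) obtain x y where 1:
    "window n p l j = x @ Lb # replicate l La @ replicate j Lb @ La # y" "length x + 1 + l = p"
    by (rule window_cases)
  from assms(2) obtain x' y' where 2:
    "zeta (l' + j' + 2) (j' + 1) = x' @ window n p' l' j' @ y'"
    "length x' + p' = length (zeta (l' + j' + 1) (j' + 1))"
    by (rule window_cases)
  have "zeta (l' + j' + 2) (j' + 1) =
      (x' @ x) @ Lb # replicate l La @ replicate j Lb @ La # (y @ y')"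
    using 1 2 eq by simp
  from zeta_block[OF _ _ \<open>1 \<le> l\<close> \<open>1 \<le> j\<close> this]
  show "l + j \<le> l' + j'" "l + j = l' + j' \<Longrightarrow> p = p'" using 1(2) 2(2) by auto
qed

lemma inj_on_window: "inj_on (\<lambda>(p, l, j). window n p l j) (good_triples n)"
proof (rule inj_onI)
  fix s t
  assume st: "s \<in> good_triples n" "t \<in> good_triples n"
    "(case s of (p, l, j) \<Rightarrow> window n p l j) = (case t of (p, l, j) \<Rightarrow> window n p l j)"
  obtain p l j p' l' j' where s: "s = (p, l, j)" and t: "t = (p', l', j')"
    by (metis prod_cases3)
  have good: "(p, l, j) \<in> good_triples n" "(p', l', j') \<in> good_triples n"
    and eq: "window n p l j = window n p' l' j'"
    using st by (simp_all add: s t)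
  have sum: "l + j = l' + j'"
    using window_eq_le(1)[OF good eq] window_eq_le(1)[OF good(2,1) eq[symmetric]] by simp
  then have p: "p = p'" by (rule window_eq_le(2)[OF good eq])
  from good(1) obtain x y where 1:
    "window n p l j = x @ Lb # replicate l La @ replicate j Lb @ La # y" "length x + 1 + l = p"
    by (rule window_cases)
  from good(2) obtain x' y' where 2:
    "window n p' l' j' = x' @ Lb # replicate l' La @ replicate j' Lb @ La # y'"
    "length x' + 1 + l' = p'"
    by (rule window_cases)
  \<comment> \<open>With \<open>p\<close> known, \<open>l\<close> is the length of the trailing
    \<open>a\<close>-run of the first \<open>p\<close> letters.\<close>
  have "take p (window n p l j) = x @ Lb # replicate l La"
    using 1 by (simp flip: 1(2))
  moreover have "take p' (window n p' l' j') = x' @ Lb # replicate l' La"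
    using 2 by (simp flip: 2(2))
  ultimately have "l = l'" using eq p trailing_run_unique by metis
  then show "s = t" using p sum by (simp add: s t)
qed

section \<open>Counting good triples\<close>

lemma finite_language: "finite {w \<in> zeta_language. length w = n}"
proof (rule finite_subset)
  have "(UNIV :: letter set) = {La, Lb}" using letter.exhaust by auto
  then have "finite (UNIV :: letter set)" by (metis finite.emptyI finite.insertI)
  then show "finite {w :: letter list. set w \<subseteq> UNIV \<and> length w = n}"
    by (rule finite_lists_length_eq)
qed auto

lemma card_good_triples_le: "card (good_triples n) \<le> complexity n"
  unfolding complexity_eq_card_language
proof (rule card_inj_on_le[OF inj_on_window _ finite_language])
  show "(\<lambda>(p, l, j). window n p l j) ` good_triples n \<subseteq> {w \<in> zeta_language. length w = n}"
    using window_in_language by auto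
qed

lemma card_good_triples_ge:
  "(\<Sum>p<n. (p - 1) * (n - p - 1)) \<le>
     card (good_triples n) + 2 * n\<^sup>2 + n * (nat \<lfloor>sqrt (2 * real n)\<rfloor> + 1)\<^sup>2"
proof -
  define M where "M = nat \<lfloor>sqrt (2 * real n)\<rfloor>"
  define A where "A = (SIGMA p:{..<n}. {1..<p} \<times> {1..<n - p})"
  \<comment> \<open>The boxes cover the triples of \<open>A\<close> with \<open>l = 1\<close>, with
    \<open>j = 1\<close>, and with \<open>(l + j)\<^sup>2 < 2 * n\<close>. As \<open>M\<close> is
    about the square root of \<open>2 * n\<close>, each has size O(n^2).\<close>
  let ?B1 = "{..<n} \<times> {1 :: nat} \<times> {..<n}" and ?B2 = "{..<n} \<times> {..<n} \<times> {1 :: nat}"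
    and ?B3 = "{..<n} \<times> {..M} \<times> {..M}"
  have small: "m \<le> M" if "m\<^sup>2 < 2 * n" for m
  proof -
    have "real (m\<^sup>2) \<le> real (2 * n)" using that by (simp only: of_nat_le_iff)
    then have "(real m)\<^sup>2 \<le> 2 * real n" by simp
    then have "real m \<le> sqrt (2 * real n)" by (rule real_le_rsqrt)
    then show ?thesis unfolding M_def by linarith
  qed
  have "A \<subseteq> good_triples n \<union> (?B1 \<union> (?B2 \<union> ?B3))"
  proof
    fix t assume "t \<in> A"
    then obtain p l j where t: "t = (p, l, j)" "p < n" "1 \<le> l" "l < p" "1 \<le> j" "p + j < n"
      by (auto simp: A_def)
    show "t \<in> good_triples n \<union> (?B1 \<union> (?B2 \<union> ?B3))"
    proof (cases "l = 1 \<or> j = 1 \<or> (l + j)\<^sup>2 < 2 * n")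
      case False
      then show ?thesis using t by (auto simp: good_triples_def)
    next
      case True
      have "l \<le> M \<and> j \<le> M" if "(l + j)\<^sup>2 < 2 * n"
        using that small[of "l + j"] by simp
      then show ?thesis using True t by auto
    qed
  qed
  moreover have "finite (good_triples n)"
    by (rule finite_subset[of _ "{..n} \<times> {..n} \<times> {..n}"]) (auto simp: good_triples_def)
  ultimately have "card A \<le> card (good_triples n \<union> (?B1 \<union> (?B2 \<union> ?B3)))"
    by (intro card_mono) auto
  also have "\<dots> \<le> card (good_triples n) + (card ?B1 + (card ?B2 + card ?B3))"
    using card_Un_le[of "good_triples n" "?B1 \<union> (?B2 \<union> ?B3)"]
      card_Un_le[of ?B1 "?B2 \<union> ?B3"] card_Un_le[of ?B2 ?B3] by linarith
  also have "\<dots> = card (good_triples n) + 2 * n\<^sup>2 + n * (M + 1)\<^sup>2"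
    by (simp add: power2_eq_square)
  finally show ?thesis by (simp add: A_def M_def)
qed

section \<open>Closed forms and the limit\<close>

lemma complexity_upper:
  assumes "2 \<le> n"
  shows "real (complexity n) \<le>
    real n ^ 2 * (real n - 1) / 2 - real n * (real n - 1) * (2 * real n - 1) / 6 + real n * (real n + 1)"
proof -
  \<comment> \<open>\<open>c\<close> is kept apart from the summation bound \<open>m\<close> so that
    induction on \<open>m\<close> works; afterwards both become \<open>n\<close>.\<close>
  have closed: "(\<Sum>p<m. (real p + 1) * (c - real p + 1)) =
     c * real m * (real m - 1) / 2 - real m * (real m - 1) * (2 * real m - 1) / 6 + real m * (c + 1)" for m :: nat and c :: real
    by (induction m) (simp_all add: field_simps)
  have "real (complexity n) \<le> (\<Sum>p<n. real (Suc p * Suc (n - p)))"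
    using complexity_le[OF assms] by (metis of_nat_le_iff of_nat_sum)
  also have "\<dots> = (\<Sum>p<n. (real p + 1) * (real n - real p + 1))"
  proof (intro sum.cong refl)
    fix p assume "p \<in> {..<n}"
    then have "real (n - p) = real n - real p" by (simp add: of_nat_diff)
    then show "real (Suc p * Suc (n - p)) = (real p + 1) * (real n - real p + 1)"
      by (simp only: of_nat_mult of_nat_Suc) (simp add: algebra_simps)
  qed
  finally show ?thesis unfolding closed by (simp add: power2_eq_square)
qed

lemma complexity_lower:
  assumes "2 \<le> n"
  shows "real n ^ 2 * (real n - 1) / 2 - real n * (real n - 1) * (2 * real n - 1) / 6
      - (real n - 1) * real n - 2 * real n ^ 2 - real n * (sqrt (2 * real n) + 1) ^ 2
    \<le> real (complexity n)"
proof -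
  define M where "M = nat \<lfloor>sqrt (2 * real n)\<rfloor>"
  \<comment> \<open>Used with \<open>c = n - 1\<close> and \<open>m = n\<close>.\<close>
  have closed: "(\<Sum>p<m. (real p - 1) * (c - real p)) =
     (c + 1) * real m * (real m - 1) / 2 - real m * (real m - 1) * (2 * real m - 1) / 6 - c * real m" for m :: nat and c :: real
    by (induction m) (simp_all add: field_simps)
  \<comment> \<open>At \<open>p = 0\<close> truncated subtraction gives 0 on the right, while the
    real term on the left is negative.\<close>
  have "(\<Sum>p<n. (real p - 1) * (real n - 1 - real p)) \<le> (\<Sum>p<n. real ((p - 1) * (n - p - 1)))"
  proof (rule sum_mono)
    fix p assume "p \<in> {..<n}"
    show "(real p - 1) * (real n - 1 - real p) \<le> real ((p - 1) * (n - p - 1))"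
    proof (cases "p = 0")
      case True
      then show ?thesis using assms by simp
    next
      case False
      then have "real (p - 1) = real p - 1" "real (n - p - 1) = real n - 1 - real p"
        using \<open>p \<in> {..<n}\<close> by (auto simp: of_nat_diff)
      then show ?thesis by (simp only: of_nat_mult order.refl)
    qed
  qed
  also have "\<dots> \<le> real (complexity n + 2 * n\<^sup>2 + n * (M + 1)\<^sup>2)"
    using card_good_triples_ge[of n] card_good_triples_le[of n] unfolding M_def
    by (simp only: of_nat_sum[symmetric] of_nat_le_iff)
  also have "\<dots> = real (complexity n) + 2 * real n ^ 2 + real n * (real M + 1)\<^sup>2"
    by simp
  also have "\<dots> \<le> real (complexity n) + 2 * real n ^ 2 + real n * (sqrt (2 * real n) + 1)\<^sup>2"
    by (intro add_left_mono mult_left_mono power_mono add_right_mono) (auto simp: M_def)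
  finally show ?thesis unfolding closed by (simp add: power2_eq_square algebra_simps)
qed

theorem theorem4p6:
  "(\<lambda>n. real (complexity n) / real n ^ 3) \<longlonglongrightarrow> 1 / 6"
proof (rule tendsto_sandwich)
  show "\<forall>\<^sub>F n in sequentially.
      (real n ^ 2 * (real n - 1) / 2 - real n * (real n - 1) * (2 * real n - 1) / 6
      - (real n - 1) * real n - 2 * real n ^ 2 - real n * (sqrt (2 * real n) + 1) ^ 2) / real n ^ 3
      \<le> real (complexity n) / real n ^ 3"
    using eventually_ge_at_top[of 2]
    by eventually_elim (intro divide_right_mono complexity_lower, auto)
  show "\<forall>\<^sub>F n in sequentially. real (complexity n) / real n ^ 3 \<le>
      (real n ^ 2 * (real n - 1) / 2 - real n * (real n - 1) * (2 * real n - 1) / 6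
      + real n * (real n + 1)) / real n ^ 3"
    using eventually_ge_at_top[of 2]
    by eventually_elim (intro divide_right_mono complexity_upper, auto)
\<comment> \<open>Both bounds are n^3/2 - n^3/3 = n^3/6 up to O(n^2); the square-root term
  contributes only about 2n^2.\<close>
qed real_asymp+

end
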